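(* Let $\eta_1,\eta_2\in L^\infty_+(\Omega)$. If $\eta_1\le \eta_2$ a.e. in $\Omega$, then $\tau_n(\eta_1)\ge \tau_n(\eta_2)$ for every $n\in\mathbb{N}$, where $\tau_n(\eta_1)$ and $\tau_n(\eta_2)$ denote the $n$-th eigenvalues (time constants) associated with $\eta_1$ and $\eta_2$, respectively.
   Context: $\Omega\subset\mathbb{R}^3$ is an open bounded domain with Lipschitz boundary and outer unit normal $\hat{\mathbf n}$. $\langle \mathbf u,\mathbf v\rangle=\int_\Omega \mathbf u\cdot\mathbf v\,\mathrm dV$ is the $L^2(\Omega;\mathbb{R}^3)$ inner product. $L^\infty_+(\Omega)$ is the set of $\theta\in L^\infty(\Omega)$ such that $\theta\ge c_0$ a.e. in $\Omega$ for some constant $c_0>0$. $H_L(\Omega)$ is the space of $\mathbf v\in L^2(\Omega;\mathbb{R}^3)$ with $\operatorname{div}\mathbf v=0$ in $\Omega$ and $\mathbf v\cdot\hat{\mathbf n}=0$ on $\partial\Omega$ (normal trace in the weak sense). The operator $A:H_L(\Omega)\to L^2(\Omega;\mathbb{R}^3)$ is $(A\mathbf v)(x)=\frac{\mu_0}{4\pi}\int_\Omega\frac{\mathbf v(x')}{\|x-x'\|}\,\mathrm dV(x')$ with $\mu_0>0$ a constant; it is compact, self-adjoint and positive definite. For $\eta\in L^\infty_+(\Omega)$ put $\|\mathbf v\|_\eta=\sqrt{\langle \eta\mathbf v,\mathbf v\rangle}$. The eigenvalues $\tau_n(\eta)$, $n=1,2,\dots$, of the generalized problem $\langle A\mathbf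 j,\mathbf w\rangle=\tau\langle\eta\mathbf j,\mathbf w\rangle$ for all $\mathbf w\in H_L(\Omega)$ are defined, together with eigenfunctions $\mathbf j_n$, inductively by $$\tau_n(\eta)=\max\{\langle A\mathbf j,\mathbf j\rangle : \mathbf j\in H_L^n(\Omega),\ \|\mathbf j\|_\eta=1\},$$ where $H_L^1(\Omega)=H_L(\Omega)$, $H_L^n(\Omega)=\{\mathbf v\in H_L(\Omega): \langle \mathbf v,\eta\mathbf j_1\rangle=\dots=\langle\mathbf v,\eta\mathbf j_{n-1}\rangle=0\}$ for $n\ge2$, and $\mathbf j_n$ is a chosen maximizer at step $n$. *)

theory Defs
  imports "HOL-Analysis.Analysis"
begin

text \<open>
  Functions on \<open>\<Omega>\<close> are total functions on \<open>real ^ 3\<close>, of which only the values on \<open>\<Omega>\<close> matter.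
  Elements of \<open>L\<^sup>2\<close> and \<open>L\<^sup>\<infinity>\<close> are given by representatives, and every notion below is
  invariant under changes on a null set.
\<close>

type_synonym vec3 = "real ^ 3"

text \<open>
  Near each boundary point \<open>p\<close>, after the rigid motion \<open>y = T (x - p)\<close>, the set is the part of
  a cylinder lying strictly above the graph of a Lipschitz function of \<open>(y\<^sub>1, y\<^sub>2)\<close>.
\<close>

definition lipschitz_boundary :: "vec3 set \<Rightarrow> bool" where
  "lipschitz_boundary \<Omega> \<longleftrightarrow>
     (\<forall>p\<in>frontier \<Omega>. \<exists>T :: vec3 \<Rightarrow> vec3. \<exists>r h L. \<exists>\<gamma> :: real ^ 2 \<Rightarrow> real.
        orthogonal_transformation T \<and> r > 0 \<and> h > 0 \<and> L-lipschitz_on UNIV \<gamma> \<and>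
        (\<forall>x. let y = T (x - p); y' = vector [y $ 1, y $ 2] :: real ^ 2 in
               norm y' < r \<and> \<bar>y $ 3\<bar> < h \<longrightarrow> (x \<in> \<Omega> \<longleftrightarrow> \<gamma> y' < y $ 3)))"

definition lipschitz_domain :: "vec3 set \<Rightarrow> bool" where
  "lipschitz_domain \<Omega> \<longleftrightarrow>
     open \<Omega> \<and> connected \<Omega> \<and> \<Omega> \<noteq> {} \<and> bounded \<Omega> \<and> lipschitz_boundary \<Omega>"

definition L2 :: "vec3 set \<Rightarrow> (vec3 \<Rightarrow> 'b::euclidean_space) set" where
  "L2 \<Omega> = {v. v \<in> borel_measurable (lebesgue_on \<Omega>) \<and>
              integrable (lebesgue_on \<Omega>) (\<lambda>x. (norm (v x))\<^sup>2)}"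

definition L2_inner :: "vec3 set \<Rightarrow> (vec3 \<Rightarrow> vec3) \<Rightarrow> (vec3 \<Rightarrow> vec3) \<Rightarrow> real" where
  "L2_inner \<Omega> u v = (\<integral>x. u x \<bullet> v x \<partial>lebesgue_on \<Omega>)"

definition Linf_pos :: "vec3 set \<Rightarrow> (vec3 \<Rightarrow> real) set" where
  "Linf_pos \<Omega> = {\<theta>. \<theta> \<in> borel_measurable (lebesgue_on \<Omega>) \<and>
                    (\<exists>C. AE x in lebesgue_on \<Omega>. \<bar>\<theta> x\<bar> \<le> C) \<and>
                    (\<exists>c\<^sub>0>0. AE x in lebesgue_on \<Omega>. c\<^sub>0 \<le> \<theta> x)}"

definition partial_deriv :: "3 \<Rightarrow> (vec3 \<Rightarrow> real) \<Rightarrow> vec3 \<Rightarrow> real" where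
  "partial_deriv i \<phi> x = frechet_derivative \<phi> (at x) (axis i 1)"

definition gradient :: "(vec3 \<Rightarrow> real) \<Rightarrow> vec3 \<Rightarrow> vec3" where
  "gradient \<phi> x = (\<chi> i. partial_deriv i \<phi> x)"

primrec continuously_differentiable :: "nat \<Rightarrow> (vec3 \<Rightarrow> real) \<Rightarrow> bool" where
  "continuously_differentiable 0 \<phi> \<longleftrightarrow> continuous_on UNIV \<phi>"
| "continuously_differentiable (Suc k) \<phi> \<longleftrightarrow>
     (\<forall>x. \<phi> differentiable (at x)) \<and>
     (\<forall>i. continuously_differentiable k (partial_deriv i \<phi>))"

text \<open>
  \<open>C\<^sub>c\<^sup>\<infinity>(\<Omega>)\<close>, its elements being extended by zero to the whole space.
\<close>

definition test_functions :: "vec3 set \<Rightarrow> (vec3 \<Rightarrow> real) set" where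
  "test_functions \<Omega> = {\<phi>. (\<forall>k. continuously_differentiable k \<phi>) \<and>
                          compact (closure {x. \<phi> x \<noteq> 0}) \<and> closure {x. \<phi> x \<noteq> 0} \<subseteq> \<Omega>}"

text \<open>\<open>\<psi> \<in> H\<^sup>1(\<Omega>)\<close> with weak gradient \<open>G\<close>.\<close>

definition H1_with_gradient :: "vec3 set \<Rightarrow> (vec3 \<Rightarrow> real) \<Rightarrow> (vec3 \<Rightarrow> vec3) \<Rightarrow> bool" where
  "H1_with_gradient \<Omega> \<psi> G \<longleftrightarrow>
     \<psi> \<in> L2 \<Omega> \<and> G \<in> L2 \<Omega> \<and>
     (\<forall>\<phi>\<in>test_functions \<Omega>.
        (\<integral>x. \<phi> x *\<^sub>R G x \<partial>lebesgue_on \<Omega>) = - (\<integral>x. \<psi> x *\<^sub>R gradient \<phi> x \<partial>lebesgue_on \<Omega>))"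

definition has_weak_divergence :: "vec3 set \<Rightarrow> (vec3 \<Rightarrow> vec3) \<Rightarrow> (vec3 \<Rightarrow> real) \<Rightarrow> bool" where
  "has_weak_divergence \<Omega> v g \<longleftrightarrow>
     (\<forall>\<phi>\<in>test_functions \<Omega>.
        (\<integral>x. g x * \<phi> x \<partial>lebesgue_on \<Omega>) = - (\<integral>x. v x \<bullet> gradient \<phi> x \<partial>lebesgue_on \<Omega>))"

text \<open>
  The normal trace of a field \<open>v \<in> L\<^sup>2\<close> with weak divergence \<open>g \<in> L\<^sup>2\<close> is the functional that
  sends the boundary trace of \<open>\<psi> \<in> H\<^sup>1(\<Omega>)\<close> to \<open>\<integral> (v \<bullet> \<nabla>\<psi> + g \<psi>)\<close> (Green's formula).
\<close>

definition zero_normal_trace :: "vec3 set \<Rightarrow> (vec3 \<Rightarrow> vec3) \<Rightarrow> (vec3 \<Rightarrow> real) \<Rightarrow> bool" where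
  "zero_normal_trace \<Omega> v g \<longleftrightarrow>
     (\<forall>\<psi> G. H1_with_gradient \<Omega> \<psi> G \<longrightarrow> (\<integral>x. v x \<bullet> G x + g x * \<psi> x \<partial>lebesgue_on \<Omega>) = 0)"

definition H_L :: "vec3 set \<Rightarrow> (vec3 \<Rightarrow> vec3) set" where
  "H_L \<Omega> = {v \<in> L2 \<Omega>. has_weak_divergence \<Omega> v (\<lambda>_. 0) \<and> zero_normal_trace \<Omega> v (\<lambda>_. 0)}"

definition A_op :: "real \<Rightarrow> vec3 set \<Rightarrow> (vec3 \<Rightarrow> vec3) \<Rightarrow> vec3 \<Rightarrow> vec3" where
  "A_op \<mu>\<^sub>0 \<Omega> v x =
     (\<mu>\<^sub>0 / (4 * pi)) *\<^sub>R (\<integral>x'. (1 / norm (x - x')) *\<^sub>R v x' \<partial>lebesgue_on \<Omega>)"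

definition weighted_norm :: "vec3 set \<Rightarrow> (vec3 \<Rightarrow> real) \<Rightarrow> (vec3 \<Rightarrow> vec3) \<Rightarrow> real" where
  "weighted_norm \<Omega> \<eta> v = sqrt (L2_inner \<Omega> (\<lambda>x. \<eta> x *\<^sub>R v x) v)"

definition H_L_step ::
  "vec3 set \<Rightarrow> (vec3 \<Rightarrow> real) \<Rightarrow> (nat \<Rightarrow> vec3 \<Rightarrow> vec3) \<Rightarrow> nat \<Rightarrow> (vec3 \<Rightarrow> vec3) set" where
  "H_L_step \<Omega> \<eta> j n = {v \<in> H_L \<Omega>. \<forall>k\<in>{1..<n}. L2_inner \<Omega> v (\<lambda>x. \<eta> x *\<^sub>R j k x) = 0}"

text \<open>
  \<open>\<tau>\<close> and \<open>j\<close> (indexed from 1) result from the successive maximization of \<open>\<langle>A j, j\<rangle>\<close>, for some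
  choice of the maximizer at each step.
\<close>

definition time_constants ::
  "real \<Rightarrow> vec3 set \<Rightarrow> (vec3 \<Rightarrow> real) \<Rightarrow> (nat \<Rightarrow> real) \<Rightarrow> (nat \<Rightarrow> vec3 \<Rightarrow> vec3) \<Rightarrow> bool" where
  "time_constants \<mu>\<^sub>0 \<Omega> \<eta> \<tau> j \<longleftrightarrow>
     (\<forall>n\<ge>1. is_arg_max (\<lambda>v. L2_inner \<Omega> (A_op \<mu>\<^sub>0 \<Omega> v) v)
                (\<lambda>v. v \<in> H_L_step \<Omega> \<eta> j n \<and> weighted_norm \<Omega> \<eta> v = 1) (j n) \<and>
            \<tau> n = L2_inner \<Omega> (A_op \<mu>\<^sub>0 \<Omega> (j n)) (j n))"

end

theory Submission imports Defs begin

text \<open>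
  The inequality is the Courant--Fischer comparison. The first \<open>n\<close> maximizers for \<open>\<eta>\<^sub>2\<close> span a space
  on which \<open>\<langle>A v, v\<rangle> \<ge> \<tau>\<^sub>n(\<eta>\<^sub>2) \<langle>\<eta>\<^sub>2 v, v\<rangle>\<close>, and it contains a nonzero \<open>v\<close> orthogonal, with respect to
  \<open>\<eta>\<^sub>1\<close>, to the first \<open>n - 1\<close> maximizers for \<open>\<eta>\<^sub>1\<close>, so that
  \<open>\<langle>A v, v\<rangle> \<le> \<tau>\<^sub>n(\<eta>\<^sub>1) \<langle>\<eta>\<^sub>1 v, v\<rangle> \<le> \<tau>\<^sub>n(\<eta>\<^sub>1) \<langle>\<eta>\<^sub>2 v, v\<rangle>\<close>. The last step needs \<open>\<tau>\<^sub>n(\<eta>\<^sub>1) \<ge> 0\<close>. Instead of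
  the positivity of \<open>A\<close>, this uses that \<open>A\<close> is Hilbert--Schmidt: as \<open>\<integral> |x - y|\<^sup>-\<^sup>2 dy\<close> over \<open>\<Omega>\<close> is
  bounded in \<open>x\<close>, Bessel's inequality bounds \<open>\<Sum>\<^sub>k \<parallel>A j\<^sub>k\<parallel>\<^sup>2\<close> over any orthonormal family, whereas a
  negative \<open>\<tau>\<^sub>n\<close> would keep all later \<open>\<parallel>A j\<^sub>k\<parallel>\<close> away from \<open>0\<close>.
\<close>

section \<open>Bilinear forms on spaces of functions\<close>

text \<open>Elements are representatives with pointwise operations, so closure is stated for the
  functions themselves and no quotient by null sets is taken.\<close>

definition fun_subspace :: "('a \<Rightarrow> 'b::real_vector) set \<Rightarrow> bool" where
  "fun_subspace V \<longleftrightarrow> (\<lambda>x. 0) \<in> V \<and> (\<forall>u\<in>V. \<forall>v\<in>V. (\<lambda>x. u x + v x) \<in> V) \<and>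
     (\<forall>c. \<forall>u\<in>V. (\<lambda>x. c *\<^sub>R u x) \<in> V)"

lemma fun_subspaceD:
  assumes "fun_subspace V"
  shows "(\<lambda>x. 0) \<in> V" and "u \<in> V \<Longrightarrow> v \<in> V \<Longrightarrow> (\<lambda>x. u x + v x) \<in> V"
    and "u \<in> V \<Longrightarrow> (\<lambda>x. c *\<^sub>R u x) \<in> V"
  using assms by (auto simp: fun_subspace_def)

lemma fun_subspace_sum:
  assumes "fun_subspace V" and "\<And>k. k \<in> F \<Longrightarrow> f k \<in> V"
  shows "(\<lambda>x. \<Sum>k\<in>F. c k *\<^sub>R f k x) \<in> V"
  using assms(2)
proof (induction F rule: infinite_finite_induct)
  case (insert k F)
  then show ?case
    using fun_subspaceD[OF assms(1)] by simp
qed (use fun_subspaceD[OF assms(1)] in auto)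

text \<open>One interface for the \<open>L2\<close> inner product, its weighted variants and the
  form of \<open>A_op\<close>. Symmetry is assumed separately where it is used: in
  \<open>Bessel\<close>, and for \<open>b\<close> in \<open>successive_maximizers\<close>.\<close>

locale bilinear_form =
  fixes V :: "('a \<Rightarrow> 'b::real_vector) set" and B :: "('a \<Rightarrow> 'b) \<Rightarrow> ('a \<Rightarrow> 'b) \<Rightarrow> real"
  assumes subspace: "fun_subspace V"
    and add_left: "\<lbrakk>u \<in> V; v \<in> V; w \<in> V\<rbrakk> \<Longrightarrow> B (\<lambda>x. u x + v x) w = B u w + B v w"
    and add_right: "\<lbrakk>u \<in> V; v \<in> V; w \<in> V\<rbrakk> \<Longrightarrow> B w (\<lambda>x. u x + v x) = B w u + B w v"
    and scale_left: "\<lbrakk>u \<in> V; w \<in> V\<rbrakk> \<Longrightarrow> B (\<lambda>x. c *\<^sub>R u x) w = c * B u w"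
    and scale_right: "\<lbrakk>u \<in> V; w \<in> V\<rbrakk> \<Longrightarrow> B w (\<lambda>x. c *\<^sub>R u x) = c * B w u"
begin

lemmas zero_mem = fun_subspaceD(1)[OF subspace]
  and add_mem = fun_subspaceD(2)[OF subspace]
  and scale_mem = fun_subspaceD(3)[OF subspace]
  and sum_mem = fun_subspace_sum[OF subspace]

lemma zero_left: "w \<in> V \<Longrightarrow> B (\<lambda>x. 0) w = 0"
  using scale_left[OF zero_mem, of w 0] by simp

lemma zero_right: "w \<in> V \<Longrightarrow> B w (\<lambda>x. 0) = 0"
  using scale_right[OF zero_mem, of w 0] by simp

lemma sum_left:
  assumes "\<And>k. k \<in> F \<Longrightarrow> f k \<in> V" and w: "w \<in> V"
  shows "B (\<lambda>x. \<Sum>k\<in>F. c k *\<^sub>R f k x) w = (\<Sum>k\<in>F. c k * B (f k) w)"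
  using assms(1)
proof (induction F rule: infinite_finite_induct)
  case (insert k F)
  then show ?case
    using add_left[OF scale_mem sum_mem w, of "f k" F f "c k" c] scale_left[OF _ w, of "f k" "c k"]
    by simp
qed (use zero_left[OF w] in auto)

lemma sum_right:
  assumes "\<And>k. k \<in> F \<Longrightarrow> f k \<in> V" and w: "w \<in> V"
  shows "B w (\<lambda>x. \<Sum>k\<in>F. c k *\<^sub>R f k x) = (\<Sum>k\<in>F. c k * B w (f k))"
  using assms(1)
proof (induction F rule: infinite_finite_induct)
  case (insert k F)
  then show ?case
    using add_right[OF scale_mem sum_mem w, of "f k" F f "c k" c] scale_right[OF _ w, of "f k" "c k"]
    by simp
qed (use zero_right[OF w] in auto)

lemma quadratic_add_scale:
  assumes "u \<in> V" "v \<in> V"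
  shows "B (\<lambda>x. u x + t *\<^sub>R v x) (\<lambda>x. u x + t *\<^sub>R v x)
    = B u u + t * (B u v + B v u) + t\<^sup>2 * B v v"
  using assms by (simp add: add_left add_right scale_left scale_right add_mem scale_mem
      power2_eq_square algebra_simps)

lemma quadratic_scale:
  assumes "u \<in> V"
  shows "B (\<lambda>x. t *\<^sub>R u x) (\<lambda>x. t *\<^sub>R u x) = t\<^sup>2 * B u u"
  using assms by (simp add: scale_left scale_right scale_mem power2_eq_square)

text \<open>In the square of a sum the mixed terms occur only as \<open>B u v + B v u\<close>, so
  this symmetrized orthogonality is what makes the quadratic form diagonal.\<close>

lemma quadratic_sum_orthogonal:
  assumes fin: "finite F" and f: "\<And>k. k \<in> F \<Longrightarrow> f k \<in> V"
    and orth: "\<And>k l. k \<in> F \<Longrightarrow> l \<in> F \<Longrightarrow> k \<noteq> l \<Longrightarrow> B (f k) (f l) + B (f l) (f k) = 0"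
  shows "B (\<lambda>x. \<Sum>k\<in>F. c k *\<^sub>R f k x) (\<lambda>x. \<Sum>k\<in>F. c k *\<^sub>R f k x)
    = (\<Sum>k\<in>F. (c k)\<^sup>2 * B (f k) (f k))"
  using fin f orth
proof (induction F rule: finite_induct)
  case empty
  show ?case using zero_left[OF zero_mem] by simp
next
  case (insert k F)
  let ?s = "\<lambda>x. \<Sum>k\<in>F. c k *\<^sub>R f k x"
  have s: "?s \<in> V" using insert.prems(1) by (intro sum_mem) auto
  have k: "f k \<in> V" using insert.prems(1) by auto
  have "B ?s (f k) + B (f k) ?s = (\<Sum>l\<in>F. c l * (B (f l) (f k) + B (f k) (f l)))"
    using sum_left[OF _ k, of F f c] sum_right[OF _ k, of F f c] insert.prems(1)
    by (simp add: sum.distrib algebra_simps)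
  also have "\<dots> = 0"
    using insert.prems(2) insert.hyps(2) by (intro sum.neutral ballI) (auto simp: mult_eq_0_iff)
  finally have cross: "B ?s (f k) + B (f k) ?s = 0" .
  have "(\<lambda>x. \<Sum>k\<in>insert k F. c k *\<^sub>R f k x) = (\<lambda>x. ?s x + c k *\<^sub>R f k x)"
    using insert.hyps by (auto simp: add.commute)
  then show ?case
    using quadratic_add_scale[OF s k, of "c k"] cross insert by simp
qed

text \<open>The square of \<open>u\<close> minus its projection \<open>s\<close> onto the span of
  the \<open>e k\<close> is nonnegative, and \<open>B u s = B s s\<close> turns this into the
  inequality.\<close>

lemma Bessel:
  assumes sym: "\<And>u v. u \<in> V \<Longrightarrow> v \<in> V \<Longrightarrow> B u v = B v u"
    and nonneg: "\<And>u. u \<in> V \<Longrightarrow> B u u \<ge> 0"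
    and fin: "finite F" and e: "\<And>k. k \<in> F \<Longrightarrow> e k \<in> V"
    and orth: "\<And>k l. k \<in> F \<Longrightarrow> l \<in> F \<Longrightarrow> B (e k) (e l) = of_bool (k = l)"
    and u: "u \<in> V"
  shows "(\<Sum>k\<in>F. (B u (e k))\<^sup>2) \<le> B u u"
proof -
  define s where "s = (\<lambda>x. \<Sum>k\<in>F. B u (e k) *\<^sub>R e k x)"
  have s: "s \<in> V" using e by (auto simp: s_def intro: sum_mem)
  have ss: "B s s = (\<Sum>k\<in>F. (B u (e k))\<^sup>2)"
    unfolding s_def using quadratic_sum_orthogonal[OF fin e, where c = "\<lambda>k. B u (e k)"] orth by simp
  have us: "B u s = (\<Sum>k\<in>F. (B u (e k))\<^sup>2)"
    unfolding s_def using sum_right[OF e u] by (simp add: power2_eq_square)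
  have "0 \<le> B (\<lambda>x. u x + (-1) *\<^sub>R s x) (\<lambda>x. u x + (-1) *\<^sub>R s x)"
    using u s by (intro nonneg add_mem scale_mem)
  also have "\<dots> = B u u - B s s"
    using quadratic_add_scale[OF u s, of "-1"] sym[OF u s] ss us by simp
  finally show ?thesis using ss by simp
qed

end

text \<open>Gaussian elimination, by induction on the equations: a zero row is dropped, any other
  row serves to eliminate one unknown.\<close>

lemma homogeneous_system_nontrivial_solution:
  fixes M :: "'i \<Rightarrow> 'k \<Rightarrow> 'f::field"
  assumes "finite I" "finite K" "card I < card K"
  shows "\<exists>c. (\<exists>k\<in>K. c k \<noteq> 0) \<and> (\<forall>i\<in>I. (\<Sum>k\<in>K. c k * M i k) = 0)"
  using assms
proof (induction I arbitrary: K M rule: finite_induct)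
  case empty
  then obtain k where "k \<in> K" by fastforce
  then show ?case by (intro exI[of _ "\<lambda>_. 1"]) auto
next
  case (insert i I)
  show ?case
  proof (cases "\<forall>k\<in>K. M i k = 0")
    case True
    then show ?thesis using insert.IH[of K M] insert by force
  next
    case False
    then obtain p where p: "p \<in> K" "M i p \<noteq> 0" by blast
    \<comment> \<open>\<open>M'\<close> holds the other rows after unknown \<open>p\<close> has been
      eliminated with row \<open>i\<close>; one equation and one unknown fewer remain.\<close>
    define M' where "M' r k = M r k - M r p * M i k / M i p" for r k
    have "card I < card (K - {p})" using insert p by auto
    then obtain c where c: "\<exists>k\<in>K - {p}. c k \<noteq> 0"
      "\<forall>r\<in>I. (\<Sum>k\<in>K - {p}. c k * M' r k) = 0"
      using insert.IH[of "K - {p}" M'] insert.prems by auto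
    define s where "s = (\<Sum>k\<in>K - {p}. c k * M i k)"
    \<comment> \<open>Back substitution: equation \<open>i\<close> fixes the value of unknown
      \<open>p\<close>.\<close>
    define d where "d = c(p := - s / M i p)"
    have split: "(\<Sum>k\<in>K. d k * M r k) = - s / M i p * M r p + (\<Sum>k\<in>K - {p}. c k * M r k)" for r
      using insert.prems p by (subst sum.remove[of K p]) (auto simp: d_def intro!: sum.cong)
    have "(\<Sum>k\<in>K. d k * M r k) = 0" if "r \<in> insert i I" for r
    proof (cases "r = i")
      case True
      then show ?thesis using split[of i] p by (simp add: s_def)
    next
      case False
      then have "0 = (\<Sum>k\<in>K - {p}. c k * M' r k)" using c that by auto
      also have "\<dots> = (\<Sum>k\<in>K - {p}. c k * M r k - M r p / M i p * (c k * M i k))"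
        by (intro sum.cong refl) (simp add: M'_def algebra_simps)
      also have "\<dots> = (\<Sum>k\<in>K - {p}. c k * M r k) - M r p / M i p * s"
        by (simp add: sum_subtractf sum_distrib_left s_def)
      finally show ?thesis using split[of r] by simp
    qed
    moreover have "\<exists>k\<in>K. d k \<noteq> 0" using c by (auto simp: d_def)
    ultimately show ?thesis by blast
  qed
qed

section \<open>Successive maximization of a Rayleigh quotient\<close>

text \<open>In the application \<open>H\<close> is \<open>H_L \<Omega>\<close>, \<open>a\<close> the
  form of \<open>A_op\<close> and \<open>b\<close> the \<eta>-weighted inner product.
  \<open>b\<close> is only semidefinite, as a field that vanishes almost everywhere need not be the
  zero function.\<close>

locale successive_maximizers =
  a: bilinear_form H a + b: bilinear_form H b
  for H :: "('a \<Rightarrow> 'b::real_vector) set" and a b +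
  fixes \<tau> :: "nat \<Rightarrow> real" and j :: "nat \<Rightarrow> 'a \<Rightarrow> 'b"
  assumes b_sym: "\<lbrakk>u \<in> H; v \<in> H\<rbrakk> \<Longrightarrow> b u v = b v u"
    and b_nonneg: "u \<in> H \<Longrightarrow> b u u \<ge> 0"
    and maximizer: "n \<ge> 1 \<Longrightarrow>
      is_arg_max (\<lambda>v. a v v) (\<lambda>v. v \<in> H \<and> (\<forall>k\<in>{1..<n}. b v (j k) = 0) \<and> b v v = 1) (j n)"
    and \<tau>_eq: "n \<ge> 1 \<Longrightarrow> \<tau> n = a (j n) (j n)"
begin

lemma j_mem: "n \<ge> 1 \<Longrightarrow> j n \<in> H"
  using maximizer[of n] by (simp add: is_arg_max_def)

text \<open>Orthogonality to the earlier maximizers is a constraint on the later one, so the order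
  of the indices decides which maximizer to look at; \<open>b_sym\<close> exchanges the arguments
  where necessary.\<close>

lemma j_orthonormal:
  assumes "k \<ge> 1" "l \<ge> 1"
  shows "b (j k) (j l) = of_bool (k = l)"
proof (rule linorder_cases[of k l])
  assume "k < l"
  then show ?thesis
    using maximizer[of l] assms b_sym[OF j_mem j_mem, of k l] by (auto simp: is_arg_max_def)
qed (use maximizer[of k] assms in \<open>auto simp: is_arg_max_def\<close>)

text \<open>After division by its \<open>b\<close>-norm, \<open>v\<close> competes with
  \<open>j n\<close>. Positivity of \<open>b v v\<close> makes this division possible.\<close>

lemma rayleigh_le:
  assumes n: "n \<ge> 1" and v: "v \<in> H" "b v v > 0" and orth: "\<And>k. k \<in> {1..<n} \<Longrightarrow> b v (j k) = 0"
  shows "a v v \<le> \<tau> n * b v v"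
proof -
  define t where "t = 1 / sqrt (b v v)"
  define w where "w = (\<lambda>x. t *\<^sub>R v x)"
  have t2: "t\<^sup>2 = 1 / b v v" using v by (simp add: t_def power_divide)
  have "w \<in> H" using v by (auto simp: w_def a.scale_mem)
  moreover have "b w (j k) = 0" if "k \<in> {1..<n}" for k
    using b.scale_left[OF v(1) j_mem] orth that by (simp add: w_def)
  moreover have "b w w = 1"
    unfolding w_def b.quadratic_scale[OF v(1)] t2 using v by simp
  ultimately have "a w w \<le> \<tau> n"
    using maximizer[OF n] \<tau>_eq[OF n] by (force simp: is_arg_max_def not_less)
  then show ?thesis
    unfolding w_def a.quadratic_scale[OF v(1)] t2 using v by (simp add: field_simps)
qed

text \<open>\<open>j n\<close> is also admissible in the earlier step \<open>k\<close>, whose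
  constraints are among its own.\<close>

lemma \<tau>_antimono:
  assumes "1 \<le> k" "k \<le> n"
  shows "\<tau> n \<le> \<tau> k"
  using rayleigh_le[of k "j n"] assms j_mem[of n] \<tau>_eq[of n] by (simp add: j_orthonormal)

text \<open>First-order condition for the maximizer \<open>j k\<close> in the admissible direction \<open>j l\<close>.\<close>

lemma a_orthogonal_less:
  assumes "1 \<le> k" "k < l"
  shows "a (j k) (j l) + a (j l) (j k) = 0"
proof (rule ccontr)
  let ?p = "a (j k) (j l) + a (j l) (j k)"
  assume p: "?p \<noteq> 0"
  have mem: "j k \<in> H" "j l \<in> H" using assms j_mem by auto
  define q where "q = \<tau> l - \<tau> k"
  \<comment> \<open>The perturbed field stays orthogonal to \<open>j 1, ..., j (k-1)\<close> because
    \<open>k < l\<close>, so the Rayleigh bound of step \<open>k\<close> applies to it; the constant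
    terms cancel.\<close>
  have le: "t * ?p + t\<^sup>2 * q \<le> 0" for t
  proof -
    define u where "u = (\<lambda>x. j k x + t *\<^sub>R j l x)"
    have u: "u \<in> H" using mem by (auto simp: u_def a.add_mem a.scale_mem)
    have "b u u = 1 + t\<^sup>2"
      unfolding u_def b.quadratic_add_scale[OF mem] using assms by (simp add: j_orthonormal)
    moreover have "b u (j i) = 0" if "i \<in> {1..<k}" for i
      unfolding u_def using that assms mem
      by (simp add: b.add_left b.scale_left b.scale_mem j_mem j_orthonormal)
    ultimately have "a u u \<le> \<tau> k * (1 + t\<^sup>2)"
      using rayleigh_le[OF assms(1) u] by (simp add: add_pos_nonneg)
    then show ?thesis
      unfolding u_def a.quadratic_add_scale[OF mem] using assms \<tau>_eq[of k] \<tau>_eq[of l]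
      by (simp add: q_def algebra_simps)
  qed
  \<comment> \<open>With this step length the linear term outweighs the quadratic one: the left side
    of \<open>le\<close> becomes \<open>t^2 * (1 + |q| + q)\<close>, which is positive.\<close>
  define t where "t = ?p / (1 + \<bar>q\<bar>)"
  have "?p = t * (1 + \<bar>q\<bar>)" by (simp add: t_def add_pos_nonneg less_imp_neq[symmetric])
  then have "t * ?p + t\<^sup>2 * q = t\<^sup>2 * (1 + \<bar>q\<bar> + q)"
    by (simp add: power2_eq_square algebra_simps)
  moreover have "t\<^sup>2 * (1 + \<bar>q\<bar> + q) > 0"
    using p by (intro mult_pos_pos) (auto simp: t_def)
  ultimately show False using le[of t] by simp
qed

lemma a_orthogonal:
  assumes "k \<ge> 1" "l \<ge> 1" "k \<noteq> l"
  shows "a (j k) (j l) + a (j l) (j k) = 0"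
  using assms a_orthogonal_less[of k l] a_orthogonal_less[of l k] by (cases "k < l") auto

text \<open>On the span of \<open>j 1, ..., j n\<close> both quadratic forms are diagonal in these
  fields: the entries of \<open>b\<close> are 1 and those of \<open>a\<close> are
  \<open>\<tau> k\<close>, each at least \<open>\<tau> n\<close>.\<close>

lemma rayleigh_span:
  fixes c :: "nat \<Rightarrow> real" and n :: nat
  defines "v \<equiv> \<lambda>x. \<Sum>k=1..n. c k *\<^sub>R j k x"
  shows "v \<in> H" and "b v v = (\<Sum>k=1..n. (c k)\<^sup>2)" and "\<tau> n * b v v \<le> a v v"
proof -
  show "v \<in> H" unfolding v_def by (intro a.sum_mem) (auto intro: j_mem)
  have "b v v = (\<Sum>k=1..n. (c k)\<^sup>2 * b (j k) (j k))"
    unfolding v_def by (intro b.quadratic_sum_orthogonal) (auto simp: j_mem j_orthonormal)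
  then show b: "b v v = (\<Sum>k=1..n. (c k)\<^sup>2)" by (simp add: j_orthonormal)
  have "a v v = (\<Sum>k=1..n. (c k)\<^sup>2 * a (j k) (j k))"
    unfolding v_def by (intro a.quadratic_sum_orthogonal) (auto simp: j_mem a_orthogonal)
  also have "\<dots> = (\<Sum>k=1..n. (c k)\<^sup>2 * \<tau> k)" by (simp add: \<tau>_eq)
  also have "\<dots> \<ge> (\<Sum>k=1..n. (c k)\<^sup>2 * \<tau> n)"
    by (intro sum_mono mult_left_mono \<tau>_antimono) auto
  finally show "\<tau> n * b v v \<le> a v v" by (simp add: b sum_distrib_left mult.commute)
qed

end

text \<open>Positivity is passed from \<open>b\<^sub>2\<close> to \<open>b\<^sub>1\<close> so that
  the test field can be normalized for the first problem; the sign of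
  \<open>\<tau>\<^sub>1 n\<close> allows \<open>b\<^sub>1 v v\<close> to be replaced by the larger
  \<open>b\<^sub>2 v v\<close>.\<close>

lemma successive_maximizers_compare:
  assumes 1: "successive_maximizers H a b\<^sub>1 \<tau>\<^sub>1 j\<^sub>1" and 2: "successive_maximizers H a b\<^sub>2 \<tau>\<^sub>2 j\<^sub>2"
    and le: "\<And>v. v \<in> H \<Longrightarrow> b\<^sub>1 v v \<le> b\<^sub>2 v v"
    and pos: "\<And>v. v \<in> H \<Longrightarrow> b\<^sub>2 v v > 0 \<Longrightarrow> b\<^sub>1 v v > 0"
    and n: "n \<ge> 1" and nonneg: "\<tau>\<^sub>1 n \<ge> 0"
  shows "\<tau>\<^sub>2 n \<le> \<tau>\<^sub>1 n"
proof -
  interpret m1: successive_maximizers H a b\<^sub>1 \<tau>\<^sub>1 j\<^sub>1 by fact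
  interpret m2: successive_maximizers H a b\<^sub>2 \<tau>\<^sub>2 j\<^sub>2 by fact
  \<comment> \<open>There are \<open>n\<close> unknown coefficients and \<open>n - 1\<close>
    orthogonality conditions.\<close>
  obtain c :: "nat \<Rightarrow> real" where c: "\<exists>k\<in>{1..n}. c k \<noteq> 0"
    "\<forall>i\<in>{1..<n}. (\<Sum>k\<in>{1..n}. c k * b\<^sub>1 (j\<^sub>2 k) (j\<^sub>1 i)) = 0"
    using homogeneous_system_nontrivial_solution[of "{1..<n}" "{1..n}"
        "\<lambda>i k. b\<^sub>1 (j\<^sub>2 k) (j\<^sub>1 i)"] n by auto
  define v where "v = (\<lambda>x. \<Sum>k=1..n. c k *\<^sub>R j\<^sub>2 k x)"
  note v = m2.rayleigh_span[where n = n and c = c, folded v_def]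
  have b2: "b\<^sub>2 v v > 0"
    unfolding v(2) using c(1) by (auto intro!: sum_pos2)
  have orth: "b\<^sub>1 v (j\<^sub>1 i) = 0" if "i \<in> {1..<n}" for i
    unfolding v_def using that c(2) by (subst m1.b.sum_left) (auto intro: m2.j_mem m1.j_mem)
  have "\<tau>\<^sub>2 n * b\<^sub>2 v v \<le> \<tau>\<^sub>1 n * b\<^sub>1 v v"
    using v(3) m1.rayleigh_le[OF n v(1) pos[OF v(1) b2] orth] by simp
  also have "\<dots> \<le> \<tau>\<^sub>1 n * b\<^sub>2 v v"
    using le[OF v(1)] nonneg by (rule mult_left_mono)
  finally show ?thesis using b2 by simp
qed

section \<open>Square-integrable fields\<close>

lemma mult_le_sum_power2: "x * y \<le> x\<^sup>2 + (y :: real)\<^sup>2"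
proof -
  have "0 \<le> (x - y)\<^sup>2 + x\<^sup>2 + y\<^sup>2" by simp
  then show ?thesis by (simp add: power2_diff)
qed

lemma integrable_inner_L2:
  assumes "u \<in> L2 \<Omega>" "v \<in> L2 \<Omega>"
  shows "integrable (lebesgue_on \<Omega>) (\<lambda>x. u x \<bullet> v x)"
proof (rule Bochner_Integration.integrable_bound)
  show "integrable (lebesgue_on \<Omega>) (\<lambda>x. (norm (u x))\<^sup>2 + (norm (v x))\<^sup>2)"
    using assms by (auto simp: L2_def)
  show "(\<lambda>x. u x \<bullet> v x) \<in> borel_measurable (lebesgue_on \<Omega>)"
    using assms by (auto simp: L2_def)
  have "\<bar>u x \<bullet> v x\<bar> \<le> (norm (u x))\<^sup>2 + (norm (v x))\<^sup>2" for x
    using Cauchy_Schwarz_ineq2 mult_le_sum_power2 by (rule order_trans)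
  then show "AE x in lebesgue_on \<Omega>. norm (u x \<bullet> v x) \<le> norm ((norm (u x))\<^sup>2 + (norm (v x))\<^sup>2)"
    by auto
qed

lemma L2_bound:
  assumes "v \<in> L2 \<Omega>" and "u \<in> borel_measurable (lebesgue_on \<Omega>)"
    and "AE x in lebesgue_on \<Omega>. norm (u x) \<le> C * norm (v x)"
  shows "u \<in> L2 \<Omega>"
proof -
  have "integrable (lebesgue_on \<Omega>) (\<lambda>x. (norm (u x))\<^sup>2)"
  proof (rule Bochner_Integration.integrable_bound)
    show "integrable (lebesgue_on \<Omega>) (\<lambda>x. C\<^sup>2 * (norm (v x))\<^sup>2)"
      using assms by (auto simp: L2_def)
    show "AE x in lebesgue_on \<Omega>. norm ((norm (u x))\<^sup>2) \<le> norm (C\<^sup>2 * (norm (v x))\<^sup>2)"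
      using assms(3)
    proof eventually_elim
      case (elim x)
      then show ?case using power_mono[OF elim, of 2] by (simp add: power_mult_distrib)
    qed
  qed (use assms in auto)
  then show ?thesis using assms by (simp add: L2_def)
qed

lemma L2_bounded:
  assumes "\<Omega> \<in> lmeasurable" and "u \<in> borel_measurable (lebesgue_on \<Omega>)"
    and "\<And>x. x \<in> \<Omega> \<Longrightarrow> norm (u x) \<le> C"
  shows "u \<in> L2 \<Omega>"
proof -
  interpret finite_measure "lebesgue_on \<Omega>"
    using assms(1) by (rule finite_measure_lebesgue_on)
  have 1: "(\<lambda>x. 1::real) \<in> L2 \<Omega>" by (simp add: L2_def)
  show ?thesis
    by (rule L2_bound[OF 1 assms(2), of C]) (auto intro!: AE_I2 assms(3))
qed

lemma fun_subspace_L2: "fun_subspace (L2 \<Omega> :: (vec3 \<Rightarrow> 'b::euclidean_space) set)"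
  unfolding fun_subspace_def
proof (intro conjI ballI allI)
  show "(\<lambda>x. 0) \<in> (L2 \<Omega> :: (vec3 \<Rightarrow> 'b) set)" by (simp add: L2_def)
next
  fix u v :: "vec3 \<Rightarrow> 'b" assume uv: "u \<in> L2 \<Omega>" "v \<in> L2 \<Omega>"
  have "(norm (u x + v x))\<^sup>2 = (norm (u x))\<^sup>2 + 2 * (u x \<bullet> v x) + (norm (v x))\<^sup>2" for x
    by (simp add: power2_norm_eq_inner inner_add_left inner_add_right inner_commute)
  then show "(\<lambda>x. u x + v x) \<in> L2 \<Omega>"
    using uv integrable_inner_L2[OF uv] by (auto simp: L2_def)
next
  fix u :: "vec3 \<Rightarrow> 'b" and c assume "u \<in> L2 \<Omega>"
  then show "(\<lambda>x. c *\<^sub>R u x) \<in> L2 \<Omega>"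
    by (auto simp: L2_def power_mult_distrib)
qed

interpretation L2_inner: bilinear_form "L2 \<Omega>" "L2_inner \<Omega>" for \<Omega>
  by unfold_locales
    (auto simp: fun_subspace_L2 L2_inner_def inner_add_left inner_add_right integrable_inner_L2)

lemma L2_inner_commute: "L2_inner \<Omega> u v = L2_inner \<Omega> v u"
  by (simp add: L2_inner_def inner_commute)

lemma L2_inner_nonneg: "L2_inner \<Omega> u u \<ge> 0"
  by (simp add: L2_inner_def)

section \<open>The weighted inner product\<close>

lemma Linf_pos_scaleR_L2:
  assumes "\<eta> \<in> Linf_pos \<Omega>" "v \<in> L2 \<Omega>"
  shows "(\<lambda>x. \<eta> x *\<^sub>R v x) \<in> L2 \<Omega>"
proof -
  obtain C where "AE x in lebesgue_on \<Omega>. \<bar>\<eta> x\<bar> \<le> C"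
    using assms by (auto simp: Linf_pos_def)
  then have "AE x in lebesgue_on \<Omega>. norm (\<eta> x *\<^sub>R v x) \<le> C * norm (v x)"
    by eventually_elim (simp add: mult_right_mono)
  then show ?thesis
    using assms by (intro L2_bound[OF assms(2)]) (auto simp: L2_def Linf_pos_def)
qed

text \<open>The weight sits on the second argument, as in \<open>H_L_step\<close>;
  \<open>weighted_norm\<close> puts it on the first, which \<open>weighted_norm_eq_1_iff\<close>
  reconciles.\<close>

abbreviation weighted_inner :: "vec3 set \<Rightarrow> (vec3 \<Rightarrow> real) \<Rightarrow> (vec3 \<Rightarrow> vec3) \<Rightarrow> (vec3 \<Rightarrow> vec3) \<Rightarrow> real"
  where "weighted_inner \<Omega> \<eta> u v \<equiv> L2_inner \<Omega> u (\<lambda>x. \<eta> x *\<^sub>R v x)"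

text \<open>Finite families keep the sums elementary; an infinite sequence is reached through bounds
  that are uniform in \<open>F\<close> and \<open>e\<close>.\<close>

definition weighted_orthonormal ::
  "vec3 set \<Rightarrow> (vec3 \<Rightarrow> real) \<Rightarrow> 'k set \<Rightarrow> ('k \<Rightarrow> vec3 \<Rightarrow> vec3) \<Rightarrow> bool" where
  "weighted_orthonormal \<Omega> \<eta> F e \<longleftrightarrow> finite F \<and> (\<forall>k\<in>F. e k \<in> L2 \<Omega>) \<and>
     (\<forall>k\<in>F. \<forall>l\<in>F. weighted_inner \<Omega> \<eta> (e k) (e l) = of_bool (k = l))"

lemma weighted_inner_commute: "weighted_inner \<Omega> \<eta> u v = weighted_inner \<Omega> \<eta> v u"
  by (simp add: L2_inner_def inner_commute)

lemma weighted_norm_eq_1_iff: "weighted_norm \<Omega> \<eta> v = 1 \<longleftrightarrow> weighted_inner \<Omega> \<eta> v v = 1"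
  by (simp add: weighted_norm_def L2_inner_commute)

lemma bilinear_form_weighted:
  assumes "\<eta> \<in> Linf_pos \<Omega>"
  shows "bilinear_form (L2 \<Omega>) (weighted_inner \<Omega> \<eta>)"
proof
  note [simp] = Linf_pos_scaleR_L2[OF assms] L2_inner.add_left L2_inner.add_right
    L2_inner.scale_left L2_inner.scale_right
  fix u v w :: "vec3 \<Rightarrow> vec3" and c :: real
  assume "u \<in> L2 \<Omega>" "w \<in> L2 \<Omega>"
  then show "weighted_inner \<Omega> \<eta> (\<lambda>x. c *\<^sub>R u x) w = c * weighted_inner \<Omega> \<eta> u w"
    and "weighted_inner \<Omega> \<eta> w (\<lambda>x. c *\<^sub>R u x) = c * weighted_inner \<Omega> \<eta> w u"
    by (simp_all add: scaleR_left_commute[of _ c] del: scaleR_scaleR)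
  assume "v \<in> L2 \<Omega>"
  then show "weighted_inner \<Omega> \<eta> (\<lambda>x. u x + v x) w = weighted_inner \<Omega> \<eta> u w + weighted_inner \<Omega> \<eta> v w"
    and "weighted_inner \<Omega> \<eta> w (\<lambda>x. u x + v x) = weighted_inner \<Omega> \<eta> w u + weighted_inner \<Omega> \<eta> w v"
    using \<open>u \<in> L2 \<Omega>\<close> \<open>w \<in> L2 \<Omega>\<close> by (simp_all add: scaleR_add_right)
qed (rule fun_subspace_L2)

lemma weighted_inner_mono:
  assumes "\<eta> \<in> Linf_pos \<Omega>" "\<theta> \<in> Linf_pos \<Omega>" "v \<in> L2 \<Omega>"
    and "AE x in lebesgue_on \<Omega>. \<eta> x \<le> \<theta> x"
  shows "weighted_inner \<Omega> \<eta> v v \<le> weighted_inner \<Omega> \<theta> v v"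
  unfolding L2_inner_def
proof (rule integral_mono_AE)
  show "AE x in lebesgue_on \<Omega>. v x \<bullet> \<eta> x *\<^sub>R v x \<le> v x \<bullet> \<theta> x *\<^sub>R v x"
    using assms(4) by eventually_elim (simp add: mult_right_mono)
qed (use assms in \<open>auto intro!: integrable_inner_L2 Linf_pos_scaleR_L2 simp del: inner_scaleR_right\<close>)

lemma const_Linf_pos: "c > 0 \<Longrightarrow> (\<lambda>x. c) \<in> Linf_pos \<Omega>"
  by (auto simp: Linf_pos_def)

text \<open>A positive constant below \<eta> is itself an admissible weight, so two weights are
  compared.\<close>

lemma weighted_inner_ge:
  assumes "\<eta> \<in> Linf_pos \<Omega>"
  obtains c where "c > 0"
    and "\<And>v. v \<in> L2 \<Omega> \<Longrightarrow> c * L2_inner \<Omega> v v \<le> weighted_inner \<Omega> \<eta> v v"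
proof -
  obtain c where c: "c > 0" "AE x in lebesgue_on \<Omega>. c \<le> \<eta> x"
    using assms by (auto simp: Linf_pos_def)
  moreover have "c * L2_inner \<Omega> v v \<le> weighted_inner \<Omega> \<eta> v v" if "v \<in> L2 \<Omega>" for v
    using weighted_inner_mono[OF const_Linf_pos[OF c(1)] assms that c(2)] that
    by (simp add: L2_inner.scale_right)
  ultimately show thesis using that by blast
qed

lemma weighted_inner_le:
  assumes "\<eta> \<in> Linf_pos \<Omega>"
  obtains C where "\<And>v. v \<in> L2 \<Omega> \<Longrightarrow> weighted_inner \<Omega> \<eta> v v \<le> C * L2_inner \<Omega> v v"
proof -
  obtain C where C: "AE x in lebesgue_on \<Omega>. \<bar>\<eta> x\<bar> \<le> C"
    using assms by (auto simp: Linf_pos_def)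
  \<comment> \<open>The maximum with 1 makes the constant a positive weight.\<close>
  have "AE x in lebesgue_on \<Omega>. \<eta> x \<le> max 1 C"
    using C by eventually_elim auto
  then have "weighted_inner \<Omega> \<eta> v v \<le> max 1 C * L2_inner \<Omega> v v" if "v \<in> L2 \<Omega>" for v
    using weighted_inner_mono[OF assms const_Linf_pos[of "max 1 C"] that] that
    by (simp add: L2_inner.scale_right)
  then show thesis using that by blast
qed

lemma weighted_inner_nonneg:
  assumes "\<eta> \<in> Linf_pos \<Omega>" "v \<in> L2 \<Omega>"
  shows "weighted_inner \<Omega> \<eta> v v \<ge> 0"
  using weighted_inner_ge[OF assms(1)] L2_inner_nonneg[of \<Omega> v] assms(2)
  by (metis mult_nonneg_nonneg less_imp_le order_trans)

text \<open>Each weighted norm is comparable to the plain \<open>L2\<close> norm, so both vanish on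
  the same fields.\<close>

lemma weighted_inner_pos_transfer:
  assumes "\<eta> \<in> Linf_pos \<Omega>" "\<theta> \<in> Linf_pos \<Omega>" "v \<in> L2 \<Omega>" "weighted_inner \<Omega> \<theta> v v > 0"
  shows "weighted_inner \<Omega> \<eta> v v > 0"
proof -
  obtain c where c: "c > 0" "c * L2_inner \<Omega> v v \<le> weighted_inner \<Omega> \<eta> v v"
    using weighted_inner_ge[OF assms(1)] assms(3) by metis
  obtain C where "weighted_inner \<Omega> \<theta> v v \<le> C * L2_inner \<Omega> v v"
    using weighted_inner_le[OF assms(2)] assms(3) by metis
  then have "L2_inner \<Omega> v v \<noteq> 0" using assms(4) by auto
  then show ?thesis
    using c L2_inner_nonneg[of \<Omega> v] by (smt (verit) mult_pos_pos)
qed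

section \<open>The space of divergence-free fields\<close>

text \<open>The gradient is continuous on the whole space, hence bounded on the compact closure of
  \<Omega>, and \<Omega> has finite measure.\<close>

lemma gradient_L2:
  assumes "open \<Omega>" "bounded \<Omega>" "\<phi> \<in> test_functions \<Omega>"
  shows "gradient \<phi> \<in> L2 \<Omega>"
proof -
  have "continuously_differentiable (Suc 0) \<phi>"
    using assms by (simp add: test_functions_def)
  then have "continuous_on UNIV (gradient \<phi>)"
    unfolding gradient_def by (auto intro!: continuous_on_vec_lambda)
  then have cont: "continuous_on S (gradient \<phi>)" for S
    using continuous_on_subset by blast
  have "compact (gradient \<phi> ` closure \<Omega>)"
    using assms cont by (intro compact_continuous_image) auto
  then obtain C where "\<forall>y\<in>gradient \<phi> ` closure \<Omega>. norm y \<le> C"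
    using compact_imp_bounded bounded_iff by metis
  then have "\<And>x. x \<in> \<Omega> \<Longrightarrow> norm (gradient \<phi> x) \<le> C"
    using closure_subset by blast
  then show ?thesis
    using assms cont
    by (intro L2_bounded) (auto intro!: continuous_imp_measurable_on_sets_lebesgue
        lmeasurable_open)
qed

lemma H_L_subset_L2: "H_L \<Omega> \<subseteq> L2 \<Omega>"
  by (auto simp: H_L_def)

text \<open>With divergence zero both defining conditions become orthogonality to gradients: to
  those of test functions, and to the weak gradients of functions in \<open>H^1\<close>.\<close>

lemma mem_H_L_iff:
  "v \<in> H_L \<Omega> \<longleftrightarrow> v \<in> L2 \<Omega> \<and> (\<forall>\<phi>\<in>test_functions \<Omega>. L2_inner \<Omega> v (gradient \<phi>) = 0) \<and>
     (\<forall>\<psi> G. H1_with_gradient \<Omega> \<psi> G \<longrightarrow> L2_inner \<Omega> v G = 0)"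
  by (auto simp: H_L_def has_weak_divergence_def zero_normal_trace_def L2_inner_def)

text \<open>\<open>H_L\<close> is the annihilator of a set of fields in \<open>L2\<close>, and
  pairing with such fields is linear.\<close>

lemma fun_subspace_H_L:
  assumes "open \<Omega>" "bounded \<Omega>"
  shows "fun_subspace (H_L \<Omega>)"
proof -
  have G: "H1_with_gradient \<Omega> \<psi> G \<Longrightarrow> G \<in> L2 \<Omega>" for \<psi> G
    by (simp add: H1_with_gradient_def)
  show ?thesis
    unfolding fun_subspace_def
    by (auto simp: mem_H_L_iff G gradient_L2[OF assms] L2_inner.zero_left L2_inner.zero_mem
        L2_inner.add_mem L2_inner.scale_mem L2_inner.add_left L2_inner.scale_left)
qed

lemma bilinear_form_subset:
  assumes "bilinear_form V B" "fun_subspace W" "W \<subseteq> V"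
  shows "bilinear_form W B"
proof -
  interpret bilinear_form V B by fact
  show ?thesis
    by unfold_locales (use assms(2,3) in \<open>auto simp: add_left add_right scale_left scale_right subset_iff\<close>)
qed

section \<open>The integral operator\<close>

text \<open>The dyadic shell \<open>2\<^sup>-\<^sup>k\<^sup>-\<^sup>1 \<le> |x - y| < 2\<^sup>-\<^sup>k\<close> contributes at most \<open>4\<^sup>k\<^sup>+\<^sup>1\<close> times a volume of order
  \<open>8\<^sup>-\<^sup>k\<close>.\<close>

lemma nn_integral_kernel_sq_bound:
  fixes \<Omega> :: "vec3 set"
  assumes "\<Omega> \<in> lmeasurable"
  shows "\<exists>M\<ge>0. \<forall>x. (\<integral>\<^sup>+y. ennreal ((1 / norm (x - y))\<^sup>2) \<partial>lebesgue_on \<Omega>) \<le> ennreal M"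
proof -
  define U where "U = unit_ball_vol 3"
  have U: "U \<ge> 0" by (simp add: U_def)
  have \<Omega>: "\<Omega> \<in> sets lebesgue" "emeasure lebesgue \<Omega> = ennreal (measure lebesgue \<Omega>)"
    using assms by (auto simp: fmeasurable_def emeasure_eq_measure2[OF assms])
  have "(\<integral>\<^sup>+y. ennreal ((1 / norm (x - y))\<^sup>2) \<partial>lebesgue_on \<Omega>)
    \<le> ennreal (measure lebesgue \<Omega> + 8 * U)" for x :: vec3
  proof -
    let ?B = "\<lambda>k. ball x ((1/2)^k) \<inter> \<Omega>"
    \<comment> \<open>On shell \<open>k\<close> the squared kernel is at most
      \<open>4 * 4^k\<close>; this bound is spread over the whole ball, whose measure is
      known.\<close>
    let ?g = "\<lambda>k y. ennreal (4 * 4^k) * indicator (?B k) y"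
    have B: "?B k \<in> sets (lebesgue_on \<Omega>)" for k
      using sets.Int[OF fmeasurableD[OF lmeasurable_ball] \<Omega>(1), of x "(1/2)^k"] \<Omega>(1)
      by (simp add: sets_restrict_space_iff)
    have pt: "ennreal ((1 / norm (x - y))\<^sup>2) \<le> 1 + (\<Sum>k. ?g k y)" if "y \<in> \<Omega>" for y
    proof (cases "norm (x - y) = 0 \<or> norm (x - y) \<ge> 1")
      \<comment> \<open>The summand 1 covers distances of at least 1, and also \<open>y = x\<close>,
        where division by zero gives 0.\<close>
      case True
      then have "(1 / norm (x - y))\<^sup>2 \<le> 1" by (auto simp: power_le_one_iff divide_le_eq)
      then have "ennreal ((1 / norm (x - y))\<^sup>2) \<le> 1" by simp
      then show ?thesis by (meson add_increasing2 zero_le)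
    next
      case False
      define r where "r = norm (x - y)"
      have r: "0 < r" "r < 1" using False by (auto simp: r_def)
      obtain m where m: "(1/2)^m \<le> r" using real_arch_pow_inv[OF r(1), of "1/2"] by (auto intro: less_imp_le)
      \<comment> \<open>The least such exponent gives \<open>(1/2)^k \<le> r < (1/2)^(k-1)\<close>;
        the shell index is the predecessor \<open>i\<close>, which exists because
        \<open>r < 1\<close>.\<close>
      define k where "k = (LEAST m. (1/2)^m \<le> r)"
      have k: "(1/2)^k \<le> r" unfolding k_def by (rule LeastI[of _ m]) (rule m)
      then have "k \<noteq> 0" using r by (intro notI) auto
      then obtain i where i: "k = Suc i" using not0_implies_Suc by blast
      have "r < (1/2)^i" using not_less_Least[of i "\<lambda>m. (1/2)^m \<le> r"] i by (auto simp: k_def)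
      then have ind: "y \<in> ?B i" using that by (auto simp: r_def dist_norm)
      have "(1 / r)\<^sup>2 \<le> (2 ^ k)\<^sup>2"
        using k r by (intro power_mono) (auto simp: field_simps power_divide)
      also have "\<dots> = 4 * 4 ^ i"
        by (simp add: i power_mult_distrib power_mult[symmetric] mult.commute[of _ 2])
           (simp add: power_mult)
      finally have "ennreal ((1 / r)\<^sup>2) \<le> ?g i y" using ind by (simp add: ennreal_leI)
      also have "\<dots> \<le> (\<Sum>k. ?g k y)"
        using sum_le_suminf[of "\<lambda>k. ?g k y" "{i}"]
        by (simp only: sum.insert sum.empty finite.intros empty_iff not_False_eq_True add_0_right
            summableI zero_le simp_thms)
      finally show ?thesis unfolding r_def by (simp add: add_increasing)
    qed
    have "(\<integral>\<^sup>+y. ennreal ((1 / norm (x - y))\<^sup>2) \<partial>lebesgue_on \<Omega>)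
      \<le> (\<integral>\<^sup>+y. 1 + (\<Sum>k. ?g k y) \<partial>lebesgue_on \<Omega>)"
      using pt by (intro nn_integral_mono) simp
    also have "\<dots> = (\<integral>\<^sup>+y. 1 \<partial>lebesgue_on \<Omega>) + (\<Sum>k. \<integral>\<^sup>+y. ?g k y \<partial>lebesgue_on \<Omega>)"
      using B by (subst nn_integral_add, simp, simp, subst nn_integral_suminf) simp_all
    also have "(\<integral>\<^sup>+y. 1 \<partial>lebesgue_on \<Omega>) = ennreal (measure lebesgue \<Omega>)"
      using \<Omega> by (simp add: emeasure_restrict_space)
    \<comment> \<open>Ball \<open>k\<close> contributes at most
      \<open>4 * 4^k * U * 8^(-k) = 4 * U * 2^(-k)\<close>, and these bounds sum to
      \<open>8 * U\<close>.\<close>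
    also have "(\<Sum>k. \<integral>\<^sup>+y. ?g k y \<partial>lebesgue_on \<Omega>) \<le> (\<Sum>k. ennreal (4 * U * (1/2)^k))"
    proof (intro suminf_le)
      fix k
      have "emeasure (lebesgue_on \<Omega>) (?B k) = emeasure lebesgue (?B k)"
        using \<Omega>(1) by (intro emeasure_restrict_space) auto
      also have "\<dots> \<le> emeasure lebesgue (ball x ((1/2)^k))"
        by (rule emeasure_mono[OF Int_lower1 fmeasurableD[OF lmeasurable_ball]])
      also have "\<dots> = ennreal (U * ((1/2)^k)^3)"
        by (simp add: emeasure_ball U_def)
      finally have "ennreal (4 * 4^k) * emeasure (lebesgue_on \<Omega>) (?B k)
        \<le> ennreal (4 * 4^k) * ennreal (U * ((1/2)^k)^3)" by (rule mult_left_mono) simp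
      also have "\<dots> = ennreal (4 * U * (4 ^ k * ((1/2)^3)^k))"
        using U by (simp add: ennreal_mult[symmetric] power_mult[symmetric] mult_ac)
      also have "4 ^ k * ((1/2)^3)^k = (1/2 :: real)^k"
        by (simp add: power_mult_distrib[symmetric] power3_eq_cube)
      finally show "(\<integral>\<^sup>+y. ?g k y \<partial>lebesgue_on \<Omega>) \<le> ennreal (4 * U * (1/2)^k)"
        using B by (simp add: nn_integral_cmult_indicator)
    qed auto
    also have "(\<Sum>k. ennreal (4 * U * (1/2)^k)) = ennreal (\<Sum>k. 4 * U * (1/2)^k)"
      using U by (intro suminf_ennreal2) (auto intro!: summable_mult summable_geometric)
    also have "(\<Sum>k. 4 * U * (1/2)^k) = 8 * U"
      by (subst suminf_mult) (auto simp: suminf_geometric)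
    finally show ?thesis using U by (simp add: ennreal_plus add_left_mono)
  qed
  then show ?thesis using U by (intro exI[of _ "measure lebesgue \<Omega> + 8 * U"]) simp
qed

lemma borel_measurable_ident_lebesgue_on:
  "(\<lambda>y. y) \<in> borel_measurable (lebesgue_on (\<Omega> :: 'a::euclidean_space set))"
  by (intro measurable_restrict_space1 measurable_completion) simp

lemma borel_measurable_diff_lebesgue_on [measurable]:
  fixes x :: vec3
  shows "(\<lambda>y. x - y) \<in> borel_measurable (lebesgue_on \<Omega>)"
  by (intro borel_measurable_diff borel_measurable_const borel_measurable_ident_lebesgue_on)

text \<open>Finiteness of the nonnegative integral gives integrability and passes the bound, uniform
  in \<open>x\<close>, to the Bochner integral.\<close>

lemma kernel_L2:
  fixes \<Omega> :: "vec3 set"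
  assumes "\<Omega> \<in> lmeasurable"
  obtains M where "M \<ge> 0" and "\<And>x. (\<lambda>y. 1 / norm (x - y)) \<in> L2 \<Omega>"
    and "\<And>x. (\<integral>y. (1 / norm (x - y))\<^sup>2 \<partial>lebesgue_on \<Omega>) \<le> M"
proof -
  obtain M where M: "M \<ge> 0"
    "\<And>x. (\<integral>\<^sup>+y. ennreal ((1 / norm (x - y))\<^sup>2) \<partial>lebesgue_on \<Omega>) \<le> ennreal M"
    using nn_integral_kernel_sq_bound[OF assms] by blast
  have int: "integrable (lebesgue_on \<Omega>) (\<lambda>y. (1 / norm (x - y))\<^sup>2)" for x
    using M(2)[of x] by (intro integrableI_nonneg) (auto simp: le_less_trans)
  have "(\<integral>y. (1 / norm (x - y))\<^sup>2 \<partial>lebesgue_on \<Omega>) \<le> M" for x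
    using nn_integral_eq_integral[OF int[of x]] M(1) M(2)[of x] by simp
  moreover have "(\<lambda>y. 1 / norm (x - y)) \<in> L2 \<Omega>" for x
    using int[of x] by (simp add: L2_def)
  ultimately show thesis using that M(1) by blast
qed

lemma integrable_scaleR_L2:
  assumes "k \<in> L2 \<Omega>" "v \<in> L2 \<Omega>"
  shows "integrable (lebesgue_on \<Omega>) (\<lambda>x. k x *\<^sub>R v x)"
proof (rule Bochner_Integration.integrable_bound)
  have "(\<lambda>x. norm (k x)) \<in> L2 \<Omega>" "(\<lambda>x. norm (v x)) \<in> L2 \<Omega>"
    using assms by (auto simp: L2_def)
  from integrable_inner_L2[OF this]
  show "integrable (lebesgue_on \<Omega>) (\<lambda>x. norm (k x) * norm (v x))" by simp
qed (use assms in \<open>auto simp: L2_def\<close>)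

section \<open>The operator as a linear map of \<open>L2\<close> into itself\<close>

context
  fixes \<Omega> :: "vec3 set"
  assumes \<Omega>: "\<Omega> \<in> lmeasurable"
begin

lemma integrable_kernel_scaleR:
  "v \<in> L2 \<Omega> \<Longrightarrow> integrable (lebesgue_on \<Omega>) (\<lambda>y. (1 / norm (x - y)) *\<^sub>R v y)"
  by (rule kernel_L2[OF \<Omega>]) (rule integrable_scaleR_L2)

text \<open>The kernel is in \<open>L2\<close> for every \<open>x\<close>, so the integrals exist
  everywhere and the two sides agree as functions, not just almost everywhere.\<close>

lemma A_op_add:
  assumes "u \<in> L2 \<Omega>" "v \<in> L2 \<Omega>"
  shows "A_op \<mu> \<Omega> (\<lambda>x. u x + v x) = (\<lambda>x. A_op \<mu> \<Omega> u x + A_op \<mu> \<Omega> v x)"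
proof
  fix x
  show "A_op \<mu> \<Omega> (\<lambda>x. u x + v x) x = A_op \<mu> \<Omega> u x + A_op \<mu> \<Omega> v x"
    using Bochner_Integration.integral_add[OF assms[THEN integrable_kernel_scaleR], of x x]
    by (simp only: A_op_def scaleR_add_right)
qed

lemma A_op_scale: "A_op \<mu> \<Omega> (\<lambda>x. c *\<^sub>R v x) = (\<lambda>x. c *\<^sub>R A_op \<mu> \<Omega> v x)"
proof
  fix x
  have "(1 / norm (x - y)) *\<^sub>R c *\<^sub>R v y = c *\<^sub>R (1 / norm (x - y)) *\<^sub>R v y" for y
    by (rule scaleR_left_commute)
  then have eq: "(\<integral>y. (1 / norm (x - y)) *\<^sub>R c *\<^sub>R v y \<partial>lebesgue_on \<Omega>)
    = c *\<^sub>R (\<integral>y. (1 / norm (x - y)) *\<^sub>R v y \<partial>lebesgue_on \<Omega>)"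
    by (simp only: integral_scaleR_right)
  show "A_op \<mu> \<Omega> (\<lambda>x. c *\<^sub>R v x) x = c *\<^sub>R A_op \<mu> \<Omega> v x"
    unfolding A_op_def eq by (rule scaleR_left_commute)
qed

text \<open>The integrand is jointly measurable in both variables, and integrating out one of them
  over a finite measure preserves measurability.\<close>

lemma A_op_measurable:
  assumes "v \<in> L2 \<Omega>"
  shows "A_op \<mu> \<Omega> v \<in> borel_measurable (lebesgue_on \<Omega>)"
proof -
  interpret finite_measure "lebesgue_on \<Omega>"
    using \<Omega> by (rule finite_measure_lebesgue_on)
  let ?P = "lebesgue_on \<Omega> \<Otimes>\<^sub>M lebesgue_on \<Omega>"
  have v: "v \<in> borel_measurable (lebesgue_on \<Omega>)" using assms by (simp add: L2_def)
  have [measurable]: "(\<lambda>p. fst p) \<in> borel_measurable ?P" "(\<lambda>p. snd p) \<in> borel_measurable ?P"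
    "(\<lambda>p. v (snd p)) \<in> borel_measurable ?P"
    using measurable_compose[OF measurable_fst borel_measurable_ident_lebesgue_on]
      measurable_compose[OF measurable_snd borel_measurable_ident_lebesgue_on]
      measurable_compose[OF measurable_snd v] by auto
  have "(\<lambda>p. (1 / norm (fst p - snd p)) *\<^sub>R v (snd p)) \<in> borel_measurable ?P"
    by measurable
  then have "(\<lambda>x. \<integral>y. (1 / norm (x - y)) *\<^sub>R v y \<partial>lebesgue_on \<Omega>) \<in> borel_measurable (lebesgue_on \<Omega>)"
    by (intro borel_measurable_lebesgue_integral) (simp add: case_prod_beta')
  then show ?thesis unfolding A_op_def by measurable
qed

text \<open>The image is even bounded: by \<open>a * b \<le> a^2 + b^2\<close> the integrand is
  dominated by the squares of the kernel and of \<open>v\<close>, whose integrals are bounded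
  uniformly in \<open>x\<close>.\<close>

lemma A_op_L2:
  assumes "v \<in> L2 \<Omega>"
  shows "A_op \<mu> \<Omega> v \<in> L2 \<Omega>"
proof -
  obtain M where M: "\<And>x. (\<lambda>y. 1 / norm (x - y)) \<in> L2 \<Omega>"
    "\<And>x. (\<integral>y. (1 / norm (x - y))\<^sup>2 \<partial>lebesgue_on \<Omega>) \<le> M"
    using kernel_L2[OF \<Omega>] by metis
  define N where "N = (\<integral>y. (norm (v y))\<^sup>2 \<partial>lebesgue_on \<Omega>)"
  have bound: "norm (\<integral>y. (1 / norm (x - y)) *\<^sub>R v y \<partial>lebesgue_on \<Omega>) \<le> M + N" for x
  proof -
    have int: "integrable (lebesgue_on \<Omega>) (\<lambda>y. (1 / norm (x - y))\<^sup>2)"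
      "integrable (lebesgue_on \<Omega>) (\<lambda>y. (norm (v y))\<^sup>2)"
      using M(1)[of x] assms by (auto simp: L2_def)
    have "norm (\<integral>y. (1 / norm (x - y)) *\<^sub>R v y \<partial>lebesgue_on \<Omega>)
      \<le> (\<integral>y. norm ((1 / norm (x - y)) *\<^sub>R v y) \<partial>lebesgue_on \<Omega>)"
      by (rule integral_norm_bound)
    also have "\<dots> \<le> (\<integral>y. (1 / norm (x - y))\<^sup>2 + (norm (v y))\<^sup>2 \<partial>lebesgue_on \<Omega>)"
    proof (rule integral_mono)
      fix y
      have "norm ((1 / norm (x - y)) *\<^sub>R v y) = 1 / norm (x - y) * norm (v y)" by simp
      also have "\<dots> \<le> (1 / norm (x - y))\<^sup>2 + (norm (v y))\<^sup>2" by (rule mult_le_sum_power2)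
      finally show "norm ((1 / norm (x - y)) *\<^sub>R v y) \<le> (1 / norm (x - y))\<^sup>2 + (norm (v y))\<^sup>2" .
    qed (use int integrable_norm[OF integrable_kernel_scaleR[OF assms, of x]] in auto)
    also have "\<dots> \<le> M + N"
      using int M(2)[of x] by (simp add: N_def)
    finally show ?thesis .
  qed
  have "norm (A_op \<mu> \<Omega> v x) \<le> \<bar>\<mu> / (4 * pi)\<bar> * (M + N)" for x
    using mult_left_mono[OF bound[of x], of "\<bar>\<mu> / (4 * pi)\<bar>"] by (simp add: A_op_def)
  then show ?thesis
    using A_op_measurable[OF assms] by (intro L2_bounded[OF \<Omega>])
qed

lemma bilinear_form_A_op: "bilinear_form (L2 \<Omega>) (\<lambda>u v. L2_inner \<Omega> (A_op \<mu> \<Omega> u) v)"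
  by unfold_locales
    (auto simp: fun_subspace_L2 A_op_L2 A_op_add A_op_scale L2_inner.add_left L2_inner.add_right
      L2_inner.scale_left L2_inner.scale_right)

section \<open>The Hilbert-Schmidt property\<close>

text \<open>For fixed \<open>x\<close> the components of \<open>A e\<^sub>k (x)\<close> are, up to a constant, the Fourier coefficients of
  the field \<open>y \<mapsto> (\<eta> y |x - y|)\<^sup>-\<^sup>1 i\<close>, where \<open>i\<close> is a basis vector.\<close>

lemma A_op_pointwise_Bessel:
  assumes \<eta>: "\<eta> \<in> Linf_pos \<Omega>"
  shows "\<exists>D. \<forall>x F e. weighted_orthonormal \<Omega> \<eta> F e \<longrightarrow>
    (\<Sum>k\<in>F. (norm (A_op \<mu> \<Omega> (e k) x))\<^sup>2) \<le> D"
proof -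
  obtain M where M: "M \<ge> 0" "\<And>x. (\<lambda>y. 1 / norm (x - y)) \<in> L2 \<Omega>"
    "\<And>x. (\<integral>y. (1 / norm (x - y))\<^sup>2 \<partial>lebesgue_on \<Omega>) \<le> M"
    using kernel_L2[OF \<Omega>] by metis
  obtain c where c: "c > 0" "AE x in lebesgue_on \<Omega>. c \<le> \<eta> x"
    using \<eta> by (auto simp: Linf_pos_def)
  have [measurable]: "\<eta> \<in> borel_measurable (lebesgue_on \<Omega>)" using \<eta> by (simp add: Linf_pos_def)
  interpret W: bilinear_form "L2 \<Omega>" "weighted_inner \<Omega> \<eta>" by (rule bilinear_form_weighted[OF \<eta>])
  define \<kappa> where "\<kappa> = \<mu> / (4 * pi)"
  define f where "f x i y = (1 / norm (x - y) / \<eta> y) *\<^sub>R i" for x i y :: vec3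
  have f: "f x i \<in> L2 \<Omega>" if "i \<in> Basis" for x i
  proof (rule L2_bound[OF M(2)[of x]])
    show "AE y in lebesgue_on \<Omega>. norm (f x i y) \<le> (1 / c) * norm (1 / norm (x - y))"
      using c(2)
    proof eventually_elim
      case (elim y)
      then have "1 / \<bar>\<eta> y\<bar> \<le> 1 / c" using c(1) by (intro divide_left_mono) auto
      then have "(1 / \<bar>\<eta> y\<bar>) * (1 / norm (x - y)) \<le> (1 / c) * (1 / norm (x - y))"
        by (rule mult_right_mono) simp
      then show ?case using that by (simp add: f_def abs_mult mult.commute)
    qed
    show "f x i \<in> borel_measurable (lebesgue_on \<Omega>)" unfolding f_def by measurable
  qed
  \<comment> \<open>The weight cancels one of the two factors \<open>1 / \<eta>\<close>; the other
    is at most \<open>1 / c\<close>.\<close>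
  have ff: "weighted_inner \<Omega> \<eta> (f x i) (f x i) \<le> M / c" if i: "i \<in> Basis" for x i
  proof -
    have "weighted_inner \<Omega> \<eta> (f x i) (f x i) \<le> (\<integral>y. (1 / c) * (1 / norm (x - y))\<^sup>2 \<partial>lebesgue_on \<Omega>)"
      unfolding L2_inner_def
    proof (rule integral_mono_AE)
      show "integrable (lebesgue_on \<Omega>) (\<lambda>y. f x i y \<bullet> \<eta> y *\<^sub>R f x i y)"
        using f[OF i] by (intro integrable_inner_L2 Linf_pos_scaleR_L2[OF \<eta>])
      show "integrable (lebesgue_on \<Omega>) (\<lambda>y. (1 / c) * (1 / norm (x - y))\<^sup>2)"
        using M(2)[of x] by (simp add: L2_def)
      show "AE y in lebesgue_on \<Omega>. f x i y \<bullet> \<eta> y *\<^sub>R f x i y \<le> (1 / c) * (1 / norm (x - y))\<^sup>2"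
        using c(2)
      proof eventually_elim
        case (elim y)
        then have "1 / \<eta> y \<le> 1 / c" using c(1) by (intro divide_left_mono) auto
        then have "(1 / \<eta> y) * (1 / norm (x - y))\<^sup>2 \<le> (1 / c) * (1 / norm (x - y))\<^sup>2"
          by (rule mult_right_mono) simp
        moreover have "f x i y \<bullet> \<eta> y *\<^sub>R f x i y = (1 / \<eta> y) * (1 / norm (x - y))\<^sup>2"
          using i c elim by (simp add: f_def power2_eq_square)
        ultimately show ?case by simp
      qed
    qed
    also have "\<dots> \<le> (1 / c) * M"
      using mult_left_mono[OF M(3)[of x], of "1 / c"] c(1) by simp
    finally show ?thesis by simp
  qed
  have fe: "A_op \<mu> \<Omega> v x \<bullet> i = \<kappa> * weighted_inner \<Omega> \<eta> (f x i) v"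
    if v: "v \<in> L2 \<Omega>" and i: "i \<in> Basis" for v x i
  proof -
    have "A_op \<mu> \<Omega> v x \<bullet> i = \<kappa> * (\<integral>y. (1 / norm (x - y)) *\<^sub>R v y \<bullet> i \<partial>lebesgue_on \<Omega>)"
      unfolding A_op_def \<kappa>_def inner_scaleR_left[of "\<mu> / (4 * pi)"]
      using integral_inner_left[OF integrable_kernel_scaleR[OF v, of x], of i] by simp
    also have "(\<integral>y. (1 / norm (x - y)) *\<^sub>R v y \<bullet> i \<partial>lebesgue_on \<Omega>) = weighted_inner \<Omega> \<eta> (f x i) v"
      unfolding L2_inner_def
    proof (rule integral_cong_AE)
      \<comment> \<open>The weight cancels wherever \<eta> is at least \<open>c\<close>, hence
        almost everywhere.\<close>
      show "AE y in lebesgue_on \<Omega>. (1 / norm (x - y)) *\<^sub>R v y \<bullet> i = f x i y \<bullet> \<eta> y *\<^sub>R v y"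
        using c(2) by eventually_elim (use c(1) in \<open>simp add: f_def inner_commute\<close>)
      show "(\<lambda>y. (1 / norm (x - y)) *\<^sub>R v y \<bullet> i) \<in> borel_measurable (lebesgue_on \<Omega>)"
        "(\<lambda>y. f x i y \<bullet> \<eta> y *\<^sub>R v y) \<in> borel_measurable (lebesgue_on \<Omega>)"
        using v f[OF i, of x] by (auto simp: L2_def simp del: inner_scaleR_left inner_scaleR_right)
    qed
    finally show ?thesis .
  qed
  have norm_sq: "(norm w)\<^sup>2 = (\<Sum>i\<in>Basis. (w \<bullet> i)\<^sup>2)" for w :: vec3
    unfolding power2_norm_eq_inner by (subst euclidean_inner) (simp add: power2_eq_square)
  show ?thesis
  proof (intro exI allI impI)
    fix x :: vec3 and F :: "'a set" and e :: "'a \<Rightarrow> vec3 \<Rightarrow> vec3"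
    assume "weighted_orthonormal \<Omega> \<eta> F e"
    then have F: "finite F" and e: "\<And>k. k \<in> F \<Longrightarrow> e k \<in> L2 \<Omega>"
      and orth: "\<And>k l. k \<in> F \<Longrightarrow> l \<in> F \<Longrightarrow> weighted_inner \<Omega> \<eta> (e k) (e l) = of_bool (k = l)"
      by (simp_all add: weighted_orthonormal_def)
    have "(\<Sum>k\<in>F. (norm (A_op \<mu> \<Omega> (e k) x))\<^sup>2)
      = (\<Sum>k\<in>F. \<Sum>i\<in>Basis. (A_op \<mu> \<Omega> (e k) x \<bullet> i)\<^sup>2)"
      by (simp only: norm_sq)
    also have "\<dots> = (\<Sum>k\<in>F. \<Sum>i\<in>Basis. \<kappa>\<^sup>2 * (weighted_inner \<Omega> \<eta> (f x i) (e k))\<^sup>2)"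
      using fe e by (intro sum.cong refl) (simp add: power_mult_distrib)
    also have "\<dots> = (\<Sum>i\<in>Basis. \<kappa>\<^sup>2 * (\<Sum>k\<in>F. (weighted_inner \<Omega> \<eta> (f x i) (e k))\<^sup>2))"
      by (subst sum.swap) (simp add: sum_distrib_left)
    \<comment> \<open>Bessel's inequality is applied for each basis vector; the resulting bound
      depends on neither \<open>x\<close>, \<open>F\<close> nor \<open>e\<close>.\<close>
    also have "\<dots> \<le> (\<Sum>i\<in>(Basis :: vec3 set). \<kappa>\<^sup>2 * (M / c))"
    proof (intro sum_mono mult_left_mono)
      fix i :: vec3 assume i: "i \<in> Basis"
      have "(\<Sum>k\<in>F. (weighted_inner \<Omega> \<eta> (f x i) (e k))\<^sup>2) \<le> weighted_inner \<Omega> \<eta> (f x i) (f x i)"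
        by (rule W.Bessel[OF weighted_inner_commute weighted_inner_nonneg[OF \<eta>] F e orth f[OF i]])
      then show "(\<Sum>k\<in>F. (weighted_inner \<Omega> \<eta> (f x i) (e k))\<^sup>2) \<le> M / c"
        using ff[OF i, of x] by simp
    qed simp
    finally show "(\<Sum>k\<in>F. (norm (A_op \<mu> \<Omega> (e k) x))\<^sup>2) \<le> (\<Sum>i\<in>(Basis :: vec3 set). \<kappa>\<^sup>2 * (M / c))" .
  qed
qed

text \<open>The pointwise bound is integrated over \<Omega>, whose measure is finite.\<close>

lemma A_op_Hilbert_Schmidt:
  assumes \<eta>: "\<eta> \<in> Linf_pos \<Omega>"
  shows "\<exists>D. \<forall>F e. weighted_orthonormal \<Omega> \<eta> F e \<longrightarrow>
    (\<Sum>k\<in>F. L2_inner \<Omega> (A_op \<mu> \<Omega> (e k)) (A_op \<mu> \<Omega> (e k))) \<le> D"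
proof -
  interpret finite_measure "lebesgue_on \<Omega>"
    using \<Omega> by (rule finite_measure_lebesgue_on)
  from A_op_pointwise_Bessel[OF \<eta>]
  obtain D where D: "\<forall>x (F :: 'a set) e. weighted_orthonormal \<Omega> \<eta> F e \<longrightarrow>
    (\<Sum>k\<in>F. (norm (A_op \<mu> \<Omega> (e k) x))\<^sup>2) \<le> D" ..
  show ?thesis
  proof (intro exI allI impI)
    fix F :: "'a set" and e :: "'a \<Rightarrow> vec3 \<Rightarrow> vec3"
    assume on: "weighted_orthonormal \<Omega> \<eta> F e"
    then have e: "\<And>k. k \<in> F \<Longrightarrow> e k \<in> L2 \<Omega>"
      by (simp add: weighted_orthonormal_def)
    have int: "integrable (lebesgue_on \<Omega>) (\<lambda>x. (norm (A_op \<mu> \<Omega> (e k) x))\<^sup>2)" if "k \<in> F" for k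
      using A_op_L2[OF e[OF that]] by (simp add: L2_def)
    have "(\<Sum>k\<in>F. L2_inner \<Omega> (A_op \<mu> \<Omega> (e k)) (A_op \<mu> \<Omega> (e k)))
      = (\<integral>x. (\<Sum>k\<in>F. (norm (A_op \<mu> \<Omega> (e k) x))\<^sup>2) \<partial>lebesgue_on \<Omega>)"
      using int by (simp add: Bochner_Integration.integral_sum L2_inner_def power2_norm_eq_inner)
    also have "\<dots> \<le> (\<integral>x. D \<partial>lebesgue_on \<Omega>)"
      using int D on by (intro integral_mono) auto
    finally show "(\<Sum>k\<in>F. L2_inner \<Omega> (A_op \<mu> \<Omega> (e k)) (A_op \<mu> \<Omega> (e k)))
      \<le> (\<integral>x. D \<partial>lebesgue_on \<Omega>)" .
  qed
qed

end

section \<open>Monotonicity of the time constants\<close>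

text \<open>Links the concrete problem to the abstract scheme; openness and boundedness supply
  finite measure and the subspace property of \<open>H_L \<Omega>\<close>.\<close>

lemma time_constants_successive_maximizers:
  assumes "open \<Omega>" "bounded \<Omega>" "\<eta> \<in> Linf_pos \<Omega>" "time_constants \<mu> \<Omega> \<eta> \<tau> j"
  shows "successive_maximizers (H_L \<Omega>) (\<lambda>u v. L2_inner \<Omega> (A_op \<mu> \<Omega> u) v) (weighted_inner \<Omega> \<eta>) \<tau> j"
proof (intro successive_maximizers.intro successive_maximizers_axioms.intro)
  have \<Omega>: "\<Omega> \<in> lmeasurable" using assms by (simp add: lmeasurable_open)
  note sub = fun_subspace_H_L[OF assms(1,2)] H_L_subset_L2[of \<Omega>]
  show "bilinear_form (H_L \<Omega>) (\<lambda>u v. L2_inner \<Omega> (A_op \<mu> \<Omega> u) v)"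
    by (rule bilinear_form_subset[OF bilinear_form_A_op[OF \<Omega>] sub])
  show "bilinear_form (H_L \<Omega>) (weighted_inner \<Omega> \<eta>)"
    by (rule bilinear_form_subset[OF bilinear_form_weighted[OF assms(3)] sub])
  show "weighted_inner \<Omega> \<eta> u u \<ge> 0" if "u \<in> H_L \<Omega>" for u
    using that sub(2) by (intro weighted_inner_nonneg[OF assms(3)]) auto
  show "weighted_inner \<Omega> \<eta> u v = weighted_inner \<Omega> \<eta> v u" for u v
    by (rule weighted_inner_commute)
  fix n :: nat assume n: "n \<ge> 1"
  then show "\<tau> n = L2_inner \<Omega> (A_op \<mu> \<Omega> (j n)) (j n)"
    using assms(4) by (simp add: time_constants_def)
  show "is_arg_max (\<lambda>v. L2_inner \<Omega> (A_op \<mu> \<Omega> v) v)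
    (\<lambda>v. v \<in> H_L \<Omega> \<and> (\<forall>k\<in>{1..<n}. weighted_inner \<Omega> \<eta> v (j k) = 0) \<and> weighted_inner \<Omega> \<eta> v v = 1)
    (j n)"
    using assms(4) n
    by (simp add: time_constants_def H_L_step_def weighted_norm_eq_1_iff conj_assoc)
qed

text \<open>By \<open>\<tau>_antimono\<close> a negative value would persist for all later indices.
  As \<open>time_constants\<close> supplies a maximizer for every index, arbitrarily many terms
  bounded below by \<open>c * t^2\<close> would enter the Hilbert-Schmidt sum.\<close>

lemma time_constants_nonneg:
  assumes "open \<Omega>" "bounded \<Omega>" and \<eta>: "\<eta> \<in> Linf_pos \<Omega>"
    and "time_constants \<mu> \<Omega> \<eta> \<tau> j" and n: "n \<ge> 1"
  shows "\<tau> n \<ge> 0"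
proof (rule ccontr)
  assume "\<not> \<tau> n \<ge> 0"
  define t where "t = - \<tau> n"
  have t: "t > 0" using \<open>\<not> \<tau> n \<ge> 0\<close> by (simp add: t_def)
  have \<Omega>: "\<Omega> \<in> lmeasurable" using assms by (simp add: lmeasurable_open)
  interpret successive_maximizers "H_L \<Omega>" "\<lambda>u v. L2_inner \<Omega> (A_op \<mu> \<Omega> u) v" "weighted_inner \<Omega> \<eta>" \<tau> j
    by (rule time_constants_successive_maximizers[OF assms(1-4)])
  have L2: "j k \<in> L2 \<Omega>" if "k \<ge> 1" for k
    using j_mem[OF that] H_L_subset_L2 by auto
  obtain c where c: "c > 0"
    "\<And>v. v \<in> L2 \<Omega> \<Longrightarrow> c * L2_inner \<Omega> v v \<le> weighted_inner \<Omega> \<eta> v v"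
    using weighted_inner_ge[OF \<eta>] by metis
  from A_op_Hilbert_Schmidt[OF \<Omega> \<eta>]
  obtain D where D: "\<forall>(F :: nat set) e. weighted_orthonormal \<Omega> \<eta> F e \<longrightarrow>
    (\<Sum>k\<in>F. L2_inner \<Omega> (A_op \<mu> \<Omega> (e k)) (A_op \<mu> \<Omega> (e k))) \<le> D" ..
  \<comment> \<open>obtained by expanding \<open>\<parallel>A j\<^sub>k + t c j\<^sub>k\<parallel>\<^sup>2 \<ge> 0\<close>\<close>
  have lower: "c * t\<^sup>2 \<le> L2_inner \<Omega> (A_op \<mu> \<Omega> (j k)) (A_op \<mu> \<Omega> (j k))" if "k \<ge> n" for k
  proof -
    have k: "k \<ge> 1" using n that by simp
    define u where "u = A_op \<mu> \<Omega> (j k)"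
    have u: "u \<in> L2 \<Omega>" unfolding u_def by (rule A_op_L2[OF \<Omega> L2[OF k]])
    \<comment> \<open>\<open>j k\<close> has weighted norm 1, and \<open>c\<close> bounds the weight
      from below.\<close>
    have "c * L2_inner \<Omega> (j k) (j k) \<le> 1"
      using c(2)[OF L2[OF k]] j_orthonormal[OF k k] by simp
    then have "(c * t\<^sup>2) * (c * L2_inner \<Omega> (j k) (j k)) \<le> (c * t\<^sup>2) * 1"
      using c(1) by (intro mult_left_mono) auto
    then have jj: "(t * c)\<^sup>2 * L2_inner \<Omega> (j k) (j k) \<le> c * t\<^sup>2"
      by (simp add: power2_eq_square mult_ac)
    have "L2_inner \<Omega> u (j k) \<le> - t"
      using \<tau>_antimono[OF n that] \<tau>_eq[OF k] by (simp add: t_def u_def)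
    then have "(t * c) * (2 * L2_inner \<Omega> u (j k)) \<le> (t * c) * (2 * - t)"
      using t c(1) by (intro mult_left_mono) auto
    then have uj: "(t * c) * (2 * L2_inner \<Omega> u (j k)) \<le> - 2 * (c * t\<^sup>2)"
      by (simp add: power2_eq_square mult_ac)
    have "0 \<le> L2_inner \<Omega> u u + (t * c) * (2 * L2_inner \<Omega> u (j k)) + (t * c)\<^sup>2 * L2_inner \<Omega> (j k) (j k)"
      using L2_inner.quadratic_add_scale[OF u L2[OF k], of "t * c"]
        L2_inner_nonneg[of \<Omega> "\<lambda>x. u x + (t * c) *\<^sub>R j k x"] L2_inner_commute[of \<Omega> "j k" u]
      by simp
    then show ?thesis using jj uj unfolding u_def by linarith
  qed
  \<comment> \<open>\<open>D\<close> does not depend on the number \<open>m\<close> of fields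
    used.\<close>
  have bound: "real m * (c * t\<^sup>2) \<le> D" for m
  proof -
    have "real m * (c * t\<^sup>2) = (\<Sum>k\<in>{n..<n + m}. c * t\<^sup>2)" by simp
    also have "\<dots> \<le> (\<Sum>k\<in>{n..<n + m}. L2_inner \<Omega> (A_op \<mu> \<Omega> (j k)) (A_op \<mu> \<Omega> (j k)))"
      by (intro sum_mono lower) simp
    also have "\<dots> \<le> D"
      using n by (intro D[rule_format]) (auto simp: weighted_orthonormal_def j_orthonormal intro: L2)
    finally show ?thesis .
  qed
  have "c * t\<^sup>2 > 0" using c(1) t by simp
  then obtain m where "D < real m * (c * t\<^sup>2)" using reals_Archimedean3 by blast
  with bound[of m] show False by simp
qed

theorem theorem4p3:
  fixes \<Omega> :: "(real ^ 3) set" and \<mu>\<^sub>0 :: real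
    and \<eta>\<^sub>1 \<eta>\<^sub>2 :: "real ^ 3 \<Rightarrow> real"
    and \<tau>\<^sub>1 \<tau>\<^sub>2 :: "nat \<Rightarrow> real"
    and j\<^sub>1 j\<^sub>2 :: "nat \<Rightarrow> real ^ 3 \<Rightarrow> real ^ 3"
  assumes "lipschitz_domain \<Omega>" and "\<mu>\<^sub>0 > 0"
    and "\<eta>\<^sub>1 \<in> Linf_pos \<Omega>" and "\<eta>\<^sub>2 \<in> Linf_pos \<Omega>"
    and "AE x in lebesgue_on \<Omega>. \<eta>\<^sub>1 x \<le> \<eta>\<^sub>2 x"
    and "time_constants \<mu>\<^sub>0 \<Omega> \<eta>\<^sub>1 \<tau>\<^sub>1 j\<^sub>1"
    and "time_constants \<mu>\<^sub>0 \<Omega> \<eta>\<^sub>2 \<tau>\<^sub>2 j\<^sub>2"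
  shows "\<forall>n\<ge>1. \<tau>\<^sub>1 n \<ge> \<tau>\<^sub>2 n"
proof (intro allI impI)
  fix n :: nat assume n: "n \<ge> 1"
  have \<Omega>: "open \<Omega>" "bounded \<Omega>" using assms(1) by (auto simp: lipschitz_domain_def)
  \<comment> \<open>The operator does not involve \<eta>, so both problems share the form
    \<open>a\<close> and differ only in the weighted form.\<close>
  show "\<tau>\<^sub>2 n \<le> \<tau>\<^sub>1 n"
  proof (rule successive_maximizers_compare[OF
        time_constants_successive_maximizers[OF \<Omega> assms(3,6)]
        time_constants_successive_maximizers[OF \<Omega> assms(4,7)] _ _ n])
    fix v assume "v \<in> H_L \<Omega>"
    then have v: "v \<in> L2 \<Omega>" using H_L_subset_L2 by auto
    show "weighted_inner \<Omega> \<eta>\<^sub>1 v v \<le> weighted_inner \<Omega> \<eta>\<^sub>2 v v"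
      by (rule weighted_inner_mono[OF assms(3,4) v assms(5)])
    show "weighted_inner \<Omega> \<eta>\<^sub>1 v v > 0" if "weighted_inner \<Omega> \<eta>\<^sub>2 v v > 0"
      by (rule weighted_inner_pos_transfer[OF assms(3,4) v that])
  qed (rule time_constants_nonneg[OF \<Omega> assms(3,6) n])
qed

end
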